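(* Let $A\subseteq\mathbb{N}$ satisfy $\operatorname{\ell BD}(A)>0$ and fix $l\in\mathbb{N}$. Then there exists $n\in\mathbb{N}$ such that for every $m\in\mathbb{N}$ there is a geometric progression $G=\{ar^i: i=0,1,\ldots,l-1\}$ with $a,r>m$ such that $G$ is an $n$-approximate subset of $A$.
   Context: $\mathbb{N}=\{1,2,3,\dots\}$. For $A\subseteq\mathbb{N}$, the (upper) Banach log density is $\operatorname{\ell BD}(A)=\lim_{n\to\infty}\sup_{k\ge1}\frac{1}{\ln n}\sum_{x\in A\cap[k,nk]}\frac1x$ (this limit exists). For $n\in\mathbb{N}$, a number $x$ is an $n$-approximation of $a$ if $x/n<a<xn$; a set $X$ is an $n$-approximate subset of $A$ if every $x\in X$ is an $n$-approximation of some $a\in A$. *)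

theory Defs
  imports "HOL-Analysis.Analysis"
begin

(* For n >= 2 the set under the supremum is bounded above by (1 + ln n) / ln n, and it is {0}
   for n < 2 (division by ln n = 0), so the real-valued SUP is a genuine supremum. *)
definition banach_log_density :: "nat set \<Rightarrow> real" where
  "banach_log_density A =
     lim (\<lambda>n::nat. SUP k\<in>{1::nat..}. 1 / ln (real n) * (\<Sum>x\<in>A \<inter> {k..n * k}. 1 / real x))"

definition is_approximation :: "nat \<Rightarrow> real \<Rightarrow> real \<Rightarrow> bool" where
  "is_approximation n x a \<longleftrightarrow> x / real n < a \<and> a < x * real n"

definition approximate_subset :: "nat \<Rightarrow> nat set \<Rightarrow> nat set \<Rightarrow> bool" where
  "approximate_subset n X A \<longleftrightarrow> (\<forall>x\<in>X. \<exists>a\<in>A. is_approximation n (real x) (real a))"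

end

theory Submission
  imports Defs
begin

text \<open>
  Write \<open>S(k, n)\<close> for the sum of \<open>1/x\<close> over \<open>x \<in> A \<inter> [k, nk]\<close>. Splitting \<open>[k, M\<^sup>q k]\<close> into the
  blocks \<open>[M\<^sup>j k, M\<^sup>j\<^sup>+\<^sup>1 k]\<close> shows that \<open>sup\<^sub>k S(k, n)\<close> is subadditive in \<open>ln n\<close>, so that, as in Fekete's
  lemma, \<open>sup\<^sub>k S(k, n) / ln n\<close> converges to its infimum \<open>\<delta>\<close>. Fix \<open>M\<close> for which this quotient is
  below \<open>(1 + \<epsilon>)\<delta>\<close>. For every \<open>q\<close> some window \<open>[k, M\<^sup>q k]\<close> carries weight at least
  \<open>(1 - \<epsilon>)\<delta> q ln M\<close>, whereas a single block carries at most \<open>(1 + \<epsilon>)\<delta> ln M\<close>; hence all but a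
  fraction \<open>2\<epsilon>\<close> of the blocks meet \<open>A\<close>. For \<open>\<epsilon> = 1/(4l)\<close> and \<open>q\<close> large, a union bound yields \<open>j\<close> such
  that the blocks with indices \<open>j, j + m, \<dots>, j + (l-1)m\<close> all meet \<open>A\<close>, and the progression
  starting at \<open>k M\<^sup>j\<close> with ratio \<open>M\<^sup>m\<close> is \<open>(M+1)\<close>-approximated by \<open>A\<close>. This avoids Szemeredi's theorem
  because \<open>M\<close> may depend on \<open>l\<close>.
\<close>

section \<open>Window weights and their maximal density\<close>

definition log_weight :: "nat set \<Rightarrow> nat \<Rightarrow> nat \<Rightarrow> real" where
  "log_weight A k n = (\<Sum>x\<in>A \<inter> {k..n * k}. 1 / real x)"

definition max_log_density :: "nat set \<Rightarrow> nat \<Rightarrow> real" where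
  "max_log_density A n = (SUP k\<in>{1::nat..}. 1 / ln (real n) * log_weight A k n)"

lemma banach_log_density_eq_lim: "banach_log_density A = lim (max_log_density A)"
  by (simp add: banach_log_density_def max_log_density_def[abs_def] log_weight_def)

text \<open>Each term is at most \<open>1 / k\<close> and there are at most \<open>n * k + 1\<close>
  of them. The bound is crude, but uniform in \<open>k\<close>, which makes the supremum over
  \<open>k\<close> genuine.\<close>

lemma log_weight_le:
  assumes "k \<ge> 1"
  shows "log_weight A k n \<le> real n + 1"
proof -
  have "log_weight A k n \<le> (\<Sum>x\<in>A \<inter> {k..n * k}. 1 / real k)"
    unfolding log_weight_def using assms by (intro sum_mono) (auto simp: frac_le)
  also have "\<dots> = real (card (A \<inter> {k..n * k})) / real k"
    by simp
  also have "\<dots> \<le> real (n * k + 1) / real k"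
  proof -
    have "card (A \<inter> {k..n * k}) \<le> card {k..n * k}"
      by (intro card_mono) auto
    also have "\<dots> \<le> n * k + 1" by simp
    finally show ?thesis by (intro divide_right_mono) (simp_all only: of_nat_le_iff of_nat_0_le_iff)
  qed
  also have "\<dots> \<le> real n + 1"
    using assms by (simp add: field_simps)
  finally show ?thesis .
qed

lemma log_weight_nonneg: "0 \<le> log_weight A k n"
  unfolding log_weight_def by (intro sum_nonneg) auto

lemma log_weight_mono: "n \<le> n' \<Longrightarrow> log_weight A k n \<le> log_weight A k n'"
  unfolding log_weight_def by (intro sum_mono2) (auto elim!: order_trans)

lemma bdd_above_log_densities:
  assumes "n \<ge> 2"
  shows "bdd_above ((\<lambda>k. 1 / ln (real n) * log_weight A k n) ` {1::nat..})"
proof (rule bdd_aboveI2)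
  fix k :: nat assume "k \<in> {1..}"
  then show "1 / ln (real n) * log_weight A k n \<le> 1 / ln (real n) * (real n + 1)"
    using assms by (intro mult_left_mono log_weight_le) auto
qed

lemma log_weight_le_max:
  assumes "n \<ge> 2" "k \<ge> 1"
  shows "log_weight A k n \<le> max_log_density A n * ln (real n)"
proof -
  have "1 / ln (real n) * log_weight A k n \<le> max_log_density A n"
    unfolding max_log_density_def
    using assms by (intro cSUP_upper bdd_above_log_densities) auto
  then show ?thesis using assms by (simp add: field_simps)
qed

lemma max_log_density_le:
  assumes "n \<ge> 2" "\<And>k. k \<ge> 1 \<Longrightarrow> log_weight A k n \<le> C"
  shows "max_log_density A n \<le> C / ln (real n)"
  unfolding max_log_density_def
  using assms by (intro cSUP_least) (auto simp: divide_right_mono)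

lemma max_log_density_nonneg:
  assumes "n \<ge> 2"
  shows "0 \<le> max_log_density A n"
proof -
  have "0 \<le> max_log_density A n * ln (real n)"
    using log_weight_nonneg[of A 1 n] log_weight_le_max[of n 1 A] assms by simp
  then show ?thesis using assms by (simp add: zero_le_mult_iff)
qed

lemma ex_log_weight_gt:
  assumes "n \<ge> 2" "c < max_log_density A n"
  shows "\<exists>k\<ge>1. c * ln (real n) < log_weight A k n"
proof -
  obtain k where "k \<ge> 1" "c < 1 / ln (real n) * log_weight A k n"
    using assms less_cSUP_iff[OF _ bdd_above_log_densities[OF assms(1)]]
    unfolding max_log_density_def by fastforce
  then show ?thesis using assms by (auto simp: field_simps)
qed

section \<open>Subadditivity and convergence to the infimum\<close>

lemma log_weight_power_le:
  assumes "q \<ge> 1"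
  shows "log_weight A k (M ^ q) \<le> (\<Sum>j<q. log_weight A (k * M ^ j) M)"
  using assms
proof (induction q rule: dec_induct)
  case base
  then show ?case by simp
next
  case (step q)
  have sub: "A \<inter> {k..M ^ Suc q * k} \<subseteq> (A \<inter> {k..M ^ q * k}) \<union> (A \<inter> {k * M ^ q..M * (k * M ^ q)})"
    by (auto simp: algebra_simps)
  have "log_weight A k (M ^ Suc q)
      \<le> (\<Sum>x\<in>(A \<inter> {k..M ^ q * k}) \<union> (A \<inter> {k * M ^ q..M * (k * M ^ q)}). 1 / real x)"
    unfolding log_weight_def by (intro sum_mono2[OF _ sub]) auto
  \<comment> \<open>Adjacent blocks share the endpoint \<open>k * M ^ q\<close>, which may be
    counted twice; hence only an inequality.\<close>
  also have "\<dots> \<le> log_weight A k (M ^ q) + log_weight A (k * M ^ q) M"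
    unfolding log_weight_def by (subst sum_Un) (auto intro!: sum_nonneg)
  finally show ?case using step by simp
qed

text \<open>Rounding \<open>n\<close> up to a power \<open>M ^ q\<close> costs at most one extra
  block. Its weight is at most \<open>B\<close>, so the error \<open>B / ln n\<close> vanishes as
  \<open>n\<close> grows.\<close>

lemma max_log_density_le_add:
  assumes "M \<ge> 2" "n \<ge> 2"
  shows "max_log_density A n \<le> max_log_density A M + max_log_density A M * ln (real M) / ln (real n)"
proof -
  define B where "B = max_log_density A M * ln (real M)"
  define q where "q = nat \<lceil>log (real M) (real n)\<rceil>"
  have pos: "0 < log (real M) (real n)" using assms by simp
  then have q1: "q \<ge> 1" unfolding q_def by linarith
  have qle: "real q \<le> ln (real n) / ln (real M) + 1"
    using pos unfolding q_def log_def by linarith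
  have "log (real M) (real n) \<le> real q"
    unfolding q_def by linarith
  then have "real n \<le> real M powr real q"
    using assms by (subst (asm) log_le_iff) auto
  then have "real n \<le> real (M ^ q)"
    using assms by (simp add: powr_realpow)
  then have nle: "n \<le> M ^ q" by (simp only: of_nat_le_iff)
  have B0: "0 \<le> B" using assms max_log_density_nonneg[of M A] by (simp add: B_def)
  have "max_log_density A n \<le> (real q * B) / ln (real n)"
  proof (rule max_log_density_le)
    fix k :: nat assume k: "k \<ge> 1"
    have "log_weight A k n \<le> log_weight A k (M ^ q)"
      by (rule log_weight_mono[OF nle])
    also have "\<dots> \<le> (\<Sum>j<q. log_weight A (k * M ^ j) M)"
      by (rule log_weight_power_le[OF q1])
    also have "\<dots> \<le> (\<Sum>j<q. B)"
      unfolding B_def using k assms by (intro sum_mono log_weight_le_max) auto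
    finally show "log_weight A k n \<le> real q * B" by simp
  qed (use assms in auto)
  also have "\<dots> \<le> ((ln (real n) / ln (real M) + 1) * B) / ln (real n)"
    using qle B0 assms by (intro divide_right_mono mult_right_mono) auto
  also have "\<dots> = max_log_density A M + B / ln (real n)"
    using assms by (simp add: B_def field_simps)
  finally show ?thesis by (simp add: B_def)
qed

text \<open>Fekete's argument: choose \<open>M\<close> with density close to the infimum and let
  \<open>n\<close> grow in \<open>max_log_density_le_add\<close>. Indices 0 and 1 are excluded
  because division by \<open>ln n\<close> = 0 makes the density 0 there.\<close>

lemma max_log_density_tendsto:
  "max_log_density A \<longlonglongrightarrow> (INF n\<in>{2..}. max_log_density A n)" (is "_ \<longlonglongrightarrow> ?I")
proof (rule order_tendstoI)
  have bdd: "bdd_below (max_log_density A ` {2..})"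
    by (rule bdd_belowI2[of _ 0]) (simp add: max_log_density_nonneg)
  fix a assume "a < ?I"
  then show "\<forall>\<^sub>F n in sequentially. a < max_log_density A n"
    using cINF_lower[OF bdd] by (intro eventually_sequentiallyI[of 2]) fastforce
next
  have bdd: "bdd_below (max_log_density A ` {2..})"
    by (rule bdd_belowI2[of _ 0]) (simp add: max_log_density_nonneg)
  fix a assume "?I < a"
  then obtain M where M: "M \<ge> 2" "max_log_density A M < a"
    using cINF_less_iff[OF _ bdd] by fastforce
  have "filterlim (\<lambda>n. ln (real n)) at_top sequentially"
    by (rule filterlim_compose[OF ln_at_top filterlim_real_sequentially])
  then have "(\<lambda>n. max_log_density A M + max_log_density A M * ln (real M) / ln (real n))
      \<longlonglongrightarrow> max_log_density A M + 0"
    by (intro tendsto_intros real_tendsto_divide_at_top[OF tendsto_const])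
  then have "\<forall>\<^sub>F n in sequentially.
      max_log_density A M + max_log_density A M * ln (real M) / ln (real n) < a"
    using M by (intro order_tendstoD(2)) auto
  then show "\<forall>\<^sub>F n in sequentially. max_log_density A n < a"
    using eventually_ge_at_top[of 2]
    by eventually_elim (use max_log_density_le_add[OF M(1)] in \<open>fastforce intro: le_less_trans\<close>)
qed

lemma banach_log_density_tendsto: "max_log_density A \<longlonglongrightarrow> banach_log_density A"
  using max_log_density_tendsto[of A] limI banach_log_density_eq_lim by metis

text \<open>As the limit is an infimum, the bound holds at every \<open>n\<close> \<ge> 2, in
  particular at all powers \<open>M ^ q\<close>.\<close>

lemma banach_log_density_le:
  assumes "n \<ge> 2"
  shows "banach_log_density A \<le> max_log_density A n"
proof -
  have "banach_log_density A = (INF n\<in>{2..}. max_log_density A n)"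
    using LIMSEQ_unique banach_log_density_tendsto max_log_density_tendsto by blast
  also have "\<dots> \<le> max_log_density A n"
    using assms by (intro cINF_lower bdd_belowI2[of _ 0]) (auto simp: max_log_density_nonneg)
  finally show ?thesis .
qed

section \<open>Windows in which few blocks miss the set\<close>

lemma ex_window_few_empty_blocks:
  assumes pos: "banach_log_density A > 0" and eps: "0 < \<epsilon>"
  shows "\<exists>M\<ge>2. \<forall>q\<ge>1. \<exists>k\<ge>1.
    real (card {j\<in>{..<q}. A \<inter> {k * M ^ j..M * (k * M ^ j)} = {}}) < 2 * \<epsilon> * real q"
proof -
  define \<delta> where "\<delta> = banach_log_density A"
  have d: "\<delta> > 0" using pos by (simp add: \<delta>_def)
  have "\<forall>\<^sub>F n in sequentially. max_log_density A n < (1 + \<epsilon>) * \<delta>"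
    using order_tendstoD(2)[OF banach_log_density_tendsto[of A]] d eps
    by (simp add: \<delta>_def)
  then have "\<forall>\<^sub>F n in sequentially. n \<ge> 2 \<and> max_log_density A n < (1 + \<epsilon>) * \<delta>"
    using eventually_ge_at_top[of "2::nat"] by eventually_elim auto
  \<comment> \<open>\<open>M\<close> is fixed before \<open>q\<close>; only the window start
    \<open>k\<close> may depend on \<open>q\<close>. This makes the final approximation constant
    independent of \<open>m\<close>.\<close>
  then obtain M where M: "M \<ge> 2" "max_log_density A M < (1 + \<epsilon>) * \<delta>"
    using eventually_sequentially by auto
  have lnM: "ln (real M) > 0" using M by simp
  have "\<exists>k\<ge>1. real (card {j\<in>{..<q}. A \<inter> {k * M ^ j..M * (k * M ^ j)} = {}}) < 2 * \<epsilon> * real q"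
    if q: "q \<ge> 1" for q
  proof -
    have Mq: "M ^ q \<ge> 2"
      using M q self_le_power[of M q] by linarith
    have "(1 - \<epsilon>) * \<delta> < max_log_density A (M ^ q)"
      using banach_log_density_le[OF Mq, of A] d eps
      by (simp add: \<delta>_def algebra_simps) (smt (verit) mult_pos_pos)
    from ex_log_weight_gt[OF Mq this] obtain k where k: "k \<ge> 1"
      and gt: "(1 - \<epsilon>) * \<delta> * ln (real (M ^ q)) < log_weight A k (M ^ q)" by auto
    define E where "E = {j\<in>{..<q}. A \<inter> {k * M ^ j..M * (k * M ^ j)} = {}}"
    have E: "E \<subseteq> {..<q}" "finite E" by (auto simp: E_def)
    have "log_weight A k (M ^ q) \<le> (\<Sum>j<q. log_weight A (k * M ^ j) M)"
      by (rule log_weight_power_le[OF q])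
    also have "\<dots> = (\<Sum>j\<in>{..<q} - E. log_weight A (k * M ^ j) M)"
      by (intro sum.mono_neutral_right) (auto simp: E_def log_weight_def)
    also have "\<dots> \<le> (\<Sum>j\<in>{..<q} - E. (1 + \<epsilon>) * \<delta> * ln (real M))"
    proof (rule sum_mono)
      fix j
      have "log_weight A (k * M ^ j) M \<le> max_log_density A M * ln (real M)"
        using M k by (intro log_weight_le_max) auto
      also have "\<dots> \<le> (1 + \<epsilon>) * \<delta> * ln (real M)"
        using M lnM by (intro mult_right_mono) auto
      finally show "log_weight A (k * M ^ j) M \<le> (1 + \<epsilon>) * \<delta> * ln (real M)" .
    qed
    also have "\<dots> = (real q - real (card E)) * ((1 + \<epsilon>) * \<delta> * ln (real M))"
      using E card_mono[OF _ E(1)] by (simp add: card_Diff_subset of_nat_diff)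
    finally have "(1 - \<epsilon>) * real q * (\<delta> * ln (real M)) < (real q - real (card E)) * (1 + \<epsilon>) * (\<delta> * ln (real M))"
      using gt M by (simp add: ln_realpow mult_ac)
    then have "(1 - \<epsilon>) * real q < (real q - real (card E)) * (1 + \<epsilon>)"
      using d lnM by (simp add: mult_less_cancel_right)
    then have "real (card E) + \<epsilon> * real (card E) < 2 * \<epsilon> * real q"
      by (simp add: algebra_simps)
    moreover have "0 \<le> \<epsilon> * real (card E)" using eps by simp
    ultimately show ?thesis using k unfolding E_def by (intro exI[of _ k]) auto
  qed
  with M show ?thesis by blast
qed

text \<open>Union bound: a start \<open>j\<close> fails only if \<open>j = e - i * m\<close> with
  \<open>e\<close> in \<open>E\<close> and \<open>i < l\<close>, so at most
  \<open>l * card E\<close> of the \<open>q - (l + 1) * m\<close> candidates fail. Starting from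
  \<open>m\<close> later makes the first term of the geometric progression exceed
  \<open>m\<close>.\<close>

lemma ex_arith_progression_avoiding:
  fixes l m q :: nat and E :: "nat set"
  assumes "finite E" and card: "l * card E + (l + 1) * m < q"
  shows "\<exists>j\<ge>m. \<forall>i<l. j + i * m < q \<and> j + i * m \<notin> E"
proof (rule ccontr)
  assume no: "\<not> ?thesis"
  have "{m..<q - l * m} \<subseteq> (\<Union>i<l. (\<lambda>e. e - i * m) ` E)"
  proof
    fix j assume j: "j \<in> {m..<q - l * m}"
    have "j + i * m < q" if "i < l" for i
    proof -
      have "i * m \<le> l * m" using that by simp
      with j show ?thesis by (simp only: atLeastLessThan_iff) linarith
    qed
    with no j obtain i where "i < l" "j + i * m \<in> E" by auto
    then show "j \<in> (\<Union>i<l. (\<lambda>e. e - i * m) ` E)"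
      by (auto intro!: bexI[of _ i] image_eqI[of _ _ "j + i * m"])
  qed
  then have "card {m..<q - l * m} \<le> card (\<Union>i<l. (\<lambda>e. e - i * m) ` E)"
    using assms(1) by (intro card_mono) auto
  also have "\<dots> \<le> (\<Sum>i<l. card ((\<lambda>e. e - i * m) ` E))"
    by (rule card_UN_le) simp
  also have "\<dots> \<le> (\<Sum>i<l. card E)"
    using assms(1) by (intro sum_mono card_image_le)
  finally show False using card by simp
qed

theorem theorem3p2:
  fixes A :: "nat set" and l :: nat
  assumes "A \<subseteq> {1..}"
    and "banach_log_density A > 0"
    and "l \<ge> 1"
  shows "\<exists>n::nat. n \<ge> 1 \<and>
           (\<forall>m::nat. m \<ge> 1 \<longrightarrow>
              (\<exists>a r :: nat. a > m \<and> r > m \<and>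
                 approximate_subset n {a * r ^ i | i. i \<in> {0..l - 1}} A))"
proof -
  obtain M where M: "M \<ge> 2" and few: "\<And>q. q \<ge> 1 \<Longrightarrow> \<exists>k\<ge>1.
      real (card {j\<in>{..<q}. A \<inter> {k * M ^ j..M * (k * M ^ j)} = {}}) < 2 * (1 / (4 * real l)) * real q"
    using ex_window_few_empty_blocks[OF assms(2), of "1 / (4 * real l)"] assms(3) by auto
  have "\<exists>a r :: nat. a > m \<and> r > m \<and>
          approximate_subset (M + 1) {a * r ^ i | i. i \<in> {0..l - 1}} A" if m: "m \<ge> 1" for m
  proof -
    \<comment> \<open>Since \<open>l * card E\<close> is below \<open>q / 2\<close>, the other half
      of \<open>q\<close> is chosen to be exactly \<open>(l + 1) * m\<close>.\<close>
    define q where "q = 2 * (l + 1) * m"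
    have "q \<ge> 1" using m by (simp add: q_def)
    then obtain k where k: "k \<ge> 1" and
      lt: "real (card {j\<in>{..<q}. A \<inter> {k * M ^ j..M * (k * M ^ j)} = {}}) < 2 * (1 / (4 * real l)) * real q"
      using few by blast
    define E where "E = {j\<in>{..<q}. A \<inter> {k * M ^ j..M * (k * M ^ j)} = {}}"
    have "real (2 * (l * card E)) < real q"
      using lt assms(3) by (simp add: E_def field_simps)
    then have "2 * (l * card E) < q" by (simp only: of_nat_less_iff)
    then have "l * card E + (l + 1) * m < q" by (simp add: q_def)
    moreover have "finite E" by (simp add: E_def)
    ultimately obtain j where j: "j \<ge> m"
      and good: "\<And>i. i < l \<Longrightarrow> j + i * m < q \<and> j + i * m \<notin> E"
      using ex_arith_progression_avoiding by metis
    have r: "m < M ^ m" using M by (intro less_exp[THEN less_le_trans] power_mono) auto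
    also have "\<dots> \<le> M ^ j" using M j by (intro power_increasing) auto
    also have "\<dots> \<le> k * M ^ j" using k by simp
    finally have a: "m < k * M ^ j" .
    \<comment> \<open>A block is closed, so its element of \<open>A\<close> may equal
      \<open>x\<close> or \<open>M * x\<close>; \<open>M + 1\<close> gives the strict inequalities
      of \<open>is_approximation\<close>.\<close>
    have "approximate_subset (M + 1) {k * M ^ j * (M ^ m) ^ i | i. i \<in> {0..l - 1}} A"
      unfolding approximate_subset_def
    proof safe
      fix i assume "i \<in> {0..l - 1}"
      then have "i < l" using assms(3) by auto
      define x where "x = k * M ^ (j + i * m)"
      have x: "k * M ^ j * (M ^ m) ^ i = x"
        by (simp add: x_def power_add mult_ac flip: power_mult)
      have x0: "x > 0" using k M by (simp add: x_def)
      obtain b where b: "b \<in> A" "x \<le> b" "b \<le> M * x"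
        using good[OF \<open>i < l\<close>] by (auto simp: E_def x_def)
      have "real x < real b * real (M + 1)"
      proof -
        have "b * 1 < b * (M + 1)" using b x0 M by (intro mult_strict_left_mono) auto
        with b have "x < b * (M + 1)" by linarith
        then show ?thesis by (metis of_nat_less_iff of_nat_mult)
      qed
      moreover have "real b < real x * real (M + 1)"
      proof -
        have "b < x * (M + 1)" using b x0 by (simp add: algebra_simps)
        then show ?thesis by (metis of_nat_less_iff of_nat_mult)
      qed
      ultimately have "is_approximation (M + 1) (real x) (real b)"
        unfolding is_approximation_def by (simp add: pos_divide_less_eq)
      with b x show "\<exists>a\<in>A. is_approximation (M + 1) (real (k * M ^ j * (M ^ m) ^ i)) (real a)"
        by metis
    qed
    with a r show ?thesis by blast
  qed
  then show ?thesis by (intro exI[of _ "M + 1"]) auto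
qed

end
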